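(* Let $\mathcal H$ be a real separable infinite-dimensional Hilbert space. A mean-zero Gaussian measure on $\mathcal H$ is characteristic if and only if it is non-degenerate.
   Context: $\langle\cdot,\cdot\rangle$ is the inner product of $\mathcal H$. A Borel probability measure $\nu$ on $\mathcal H$ is Gaussian if for each $x\in\mathcal H$ the push-forward of $\nu$ under $y\mapsto\langle x,y\rangle$ is a normal distribution on $\mathbb R$ with some mean $\mu_x\in\mathbb R$ and variance $\sigma_x^2\ge 0$ (a point mass if $\sigma_x^2=0$). Its mean $\mu$ and covariance operator $C$ are defined by $\langle\mu,x\rangle=\int_{\mathcal H}\langle w,x\rangle\,\nu(\mathrm dw)$ and $\langle Cx,y\rangle=\int_{\mathcal H}\langle x,w-\mu\rangle\langle y,w-\mu\rangle\,\nu(\mathrm dw)$. It is non-degenerate if $C$ is strictly positive definite ($\langle Cx,x\rangle>0$ for all $x\ne0$). The characteristic functional of a Borel probability measure $\mathbb P$ on $\mathcal H$ is $\varphi_{\mathbb P}(w)=\int_{\mathcal H}\exp(\mathrm i\langle w,z\rangle)\,\mathbb P(\mathrm dz)$, and $\operatorname{Ed}_\nu^2(\mathbb P,\mathbb Q)=\int_{\mathcal H}|\varphi_{\mathbb P}(w)-\varphi_{\mathbb Q}(w)|^2\,\nu(\mathrm dw)$. A Borel probability measure $\nu$ on $\mathcal H$ is characteristic if for all Borel probability measures $\mathbb P,\mathbb Q$ on $\mathcal H$: $\operatorname{Ed}_\nu^2(\mathbb P,\mathbb Q)=0$ if and only if $\mathbb P=\mathbb Q$. *)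

theory Defs
  imports "HOL-Probability.Probability"
begin

text \<open>
  A real separable Hilbert space is a type of sort \<open>{real_inner, polish_space}\<close>: completeness
  together with second countability, which for metric spaces is the same as separability.
\<close>

definition infinite_dimensional :: "'a::real_vector itself \<Rightarrow> bool" where
  "infinite_dimensional _ \<longleftrightarrow> \<not> (\<exists>B::'a set. finite B \<and> span B = UNIV)"

definition borel_prob :: "'a::topological_space measure \<Rightarrow> bool" where
  "borel_prob M \<longleftrightarrow> prob_space M \<and> sets M = sets borel"

text \<open>The parameter \<open>\<sigma>\<close> is the standard deviation, as in \<^const>\<open>normal_density\<close>.\<close>

definition normal_distribution :: "real \<Rightarrow> real \<Rightarrow> real measure" where
  "normal_distribution \<mu> \<sigma> =
     (if \<sigma> = 0 then return borel \<mu> else density lborel (normal_density \<mu> \<sigma>))"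

definition gaussian :: "'a::{real_inner, polish_space} measure \<Rightarrow> bool" where
  "gaussian \<nu> \<longleftrightarrow> borel_prob \<nu> \<and>
     (\<forall>x. \<exists>\<mu> \<sigma>. \<sigma> \<ge> 0 \<and> distr \<nu> borel (\<lambda>y. x \<bullet> y) = normal_distribution \<mu> \<sigma>)"

text \<open>
  Mean and covariance operator are relations, so that nothing depends on unspecified values when
  the integrals diverge; each is unique by the lemmas below. For a Gaussian measure both exist.
  Linearity and boundedness of the covariance operator follow from its defining equation.
\<close>

definition is_mean :: "'a::{real_inner, polish_space} measure \<Rightarrow> 'a \<Rightarrow> bool" where
  "is_mean \<nu> \<mu> \<longleftrightarrow> (\<forall>x. has_bochner_integral \<nu> (\<lambda>w. w \<bullet> x) (\<mu> \<bullet> x))"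

definition is_covariance_operator ::
    "'a::{real_inner, polish_space} measure \<Rightarrow> ('a \<Rightarrow> 'a) \<Rightarrow> bool" where
  "is_covariance_operator \<nu> C \<longleftrightarrow>
     (\<exists>\<mu>. is_mean \<nu> \<mu> \<and>
       (\<forall>x y. has_bochner_integral \<nu> (\<lambda>w. (x \<bullet> (w - \<mu>)) * (y \<bullet> (w - \<mu>))) (C x \<bullet> y)))"

lemma is_mean_unique:
  assumes "is_mean \<nu> \<mu>" "is_mean \<nu> \<mu>'"
  shows "\<mu> = \<mu>'"
proof -
  have "\<mu> \<bullet> x = \<mu>' \<bullet> x" for x
    using assms has_bochner_integral_eq unfolding is_mean_def by blast
  then show ?thesis
    by (metis inner_commute vector_eq_rdot)
qed

lemma is_covariance_operator_unique:
  assumes "is_covariance_operator \<nu> C" "is_covariance_operator \<nu> D"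
  shows "C = D"
proof
  fix x
  have "C x \<bullet> y = D x \<bullet> y" for y
    using assms is_mean_unique has_bochner_integral_eq
    unfolding is_covariance_operator_def by metis
  then show "C x = D x"
    by (metis inner_commute vector_eq_rdot)
qed

definition nondegenerate :: "'a::{real_inner, polish_space} measure \<Rightarrow> bool" where
  "nondegenerate \<nu> \<longleftrightarrow>
     (\<exists>C. is_covariance_operator \<nu> C \<and> (\<forall>x. x \<noteq> 0 \<longrightarrow> C x \<bullet> x > 0))"

definition char_functional :: "'a::{real_inner, polish_space} measure \<Rightarrow> 'a \<Rightarrow> complex" where
  "char_functional P w = (CLINT z|P. iexp (w \<bullet> z))"

definition Ed_sq ::
    "'a::{real_inner, polish_space} measure \<Rightarrow> 'a measure \<Rightarrow> 'a measure \<Rightarrow> real" where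
  "Ed_sq \<nu> P Q = (LINT w|\<nu>. (cmod (char_functional P w - char_functional Q w))\<^sup>2)"

definition characteristic :: "'a::{real_inner, polish_space} measure \<Rightarrow> bool" where
  "characteristic \<nu> \<longleftrightarrow> borel_prob \<nu> \<and>
     (\<forall>P Q. borel_prob P \<longrightarrow> borel_prob Q \<longrightarrow> (Ed_sq \<nu> P Q = 0 \<longleftrightarrow> P = Q))"

end

theory Submission
  imports Defs
begin

text \<open>
  The distance \<^const>\<open>Ed_sq\<close> vanishes iff the characteristic functionals of \<open>P\<close> and \<open>Q\<close> agree
  \<open>\<nu>\<close>-almost everywhere. Since characteristic functionals are continuous and determine the measure
  (\<open>finite_borel_measure_eqI_char_functional\<close>), a measure \<open>\<nu>\<close> that charges every nonempty open set is
  characteristic. On the other hand, a measure \<open>\<nu>\<close> concentrated on a hyperplane orthogonal to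
  some \<open>x \<noteq> 0\<close> cannot tell the point masses at \<open>x\<close> and at \<open>0\<close> apart.

  For a centred Gaussian measure with covariance operator \<open>C\<close>, the second situation means \<open>C x \<bullet> x = 0\<close>. Here
  the operator has to be constructed first (\<open>covariance_operator_exists\<close>): the covariance form is bounded because
  the characteristic functional is continuous at \<open>0\<close>, and Riesz representation yields \<open>C\<close>.

  If \<open>C\<close> is strictly positive, then \<open>\<nu>\<close> has full support (\<open>nondegenerate_full_support\<close>). The law of \<open>\<nu>\<close> does not
  change if the coordinate \<open>x \<bullet> u\<close> of a random point \<open>u\<close> is replaced by an independent copy while \<open>u\<close> moves in
  direction \<open>C x\<close> (\<open>resample_direction\<close>). The new coordinate has a positive density on the line, so open null
  sets remain null under translation by \<open>C x\<close>. As the range of \<open>C\<close> is dense, the only open null set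
  is the empty one.

  Uniqueness of characteristic functionals is reduced to the one-dimensional theorem of Levy by
  restricting the measures to half-spaces one at a time (\<open>weighted_char_restrict\<close>).
\<close>

section \<open>Riesz representation and orthogonal projection\<close>

text \<open>
  The minimiser of \<open>z \<bullet> z - 2 * f z\<close> over \<open>V\<close> is the representing vector: by the parallelogram law
  minimising sequences are Cauchy, and the derivative at the minimum vanishes in every direction of \<open>V\<close>.
  With \<open>V = UNIV\<close> this is Riesz representation; with \<open>f = (\<bullet>) p\<close> it is the orthogonal projection of \<open>p\<close> to \<open>V\<close>.
\<close>

lemma riesz_on_closed_subspace:
  fixes f :: "'a::{real_inner, complete_space} \<Rightarrow> real"
  assumes "linear f" and bound: "\<And>x. \<bar>f x\<bar> \<le> K * norm x"
    and "closed V" and "subspace V"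
  obtains z where "z \<in> V" and "\<And>h. h \<in> V \<Longrightarrow> f h = z \<bullet> h"
proof -
  interpret f: linear f by fact
  define q where "q x = x \<bullet> x - 2 * f x" for x
  define m where "m = Inf (q ` V)"
  have "- (K\<^sup>2) \<le> q x" for x
  proof -
    have "0 \<le> (norm x - K)\<^sup>2" by simp
    also have "\<dots> = x \<bullet> x - 2 * (K * norm x) + K\<^sup>2"
      by (simp add: power2_diff dot_square_norm)
    also have "\<dots> \<le> q x + K\<^sup>2"
      using bound[of x] by (simp add: q_def)
    finally show ?thesis by simp
  qed
  then have bdd: "bdd_below (q ` V)" by (intro bdd_belowI2)
  have "q ` V \<noteq> {}" using \<open>subspace V\<close> subspace_0 by blast
  have m_le: "m \<le> q x" if "x \<in> V" for x
    using that bdd by (simp add: m_def cINF_lower)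
  have "\<exists>x\<in>V. q x < m + inverse (real (Suc n))" for n
    using cInf_lessD[OF \<open>q ` V \<noteq> {}\<close>, of "m + inverse (real (Suc n))"] by (auto simp: m_def)
  then obtain X where XV: "\<And>n. X n \<in> V" and X: "\<And>n. q (X n) < m + inverse (real (Suc n))"
    by metis
  have parallelogram: "(dist x y)\<^sup>2 \<le> 2 * (q x - m) + 2 * (q y - m)" if "x \<in> V" "y \<in> V" for x y
  proof -
    have "(1/2) *\<^sub>R (x + y) \<in> V"
      using that \<open>subspace V\<close> by (simp add: subspace_add subspace_scale)
    note m_le[OF this]
    moreover have "(dist x y)\<^sup>2 = 2 * q x + 2 * q y - 4 * q ((1/2) *\<^sub>R (x + y))"
      by (simp add: q_def dist_norm power2_norm_eq_inner f.add f.scale algebra_simps inner_commute)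
    ultimately show ?thesis by simp
  qed
  have inv: "(\<lambda>n. inverse (real (Suc n))) \<longlonglongrightarrow> 0" by (rule LIMSEQ_inverse_real_of_nat)
  have "Cauchy X"
  proof (rule metric_CauchyI)
    fix e :: real assume "0 < e"
    then have "0 < e\<^sup>2 / 4" by simp
    then obtain N where N: "inverse (real (Suc n)) < e\<^sup>2 / 4" if "n \<ge> N" for n
      using order_tendstoD(2)[OF inv] unfolding eventually_sequentially by blast
    have "dist (X i) (X j) < e" if "i \<ge> N" "j \<ge> N" for i j
    proof -
      have "(dist (X i) (X j))\<^sup>2 < e\<^sup>2"
      proof -
        have "q (X k) < m + e\<^sup>2 / 4" if "k \<ge> N" for k
          using less_trans[OF X add_strict_left_mono[OF N[OF that]]] .
        from this[OF that(1)] this[OF that(2)] parallelogram[OF XV XV, of i j] show ?thesis by argo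
      qed
      then show ?thesis using \<open>0 < e\<close> power_less_imp_less_base by fastforce
    qed
    then show "\<exists>M. \<forall>i\<ge>M. \<forall>j\<ge>M. dist (X i) (X j) < e" by blast
  qed
  then obtain z where z: "X \<longlonglongrightarrow> z" using Cauchy_convergent convergentD by blast
  then have "z \<in> V" using closed_sequentially[OF \<open>closed V\<close>] XV by blast
  have "bounded_linear f"
    using bound by (intro bounded_linear_intro[of f K]) (auto simp: f.add f.scale mult.commute)
  note bounded_linear.tendsto[OF this z]
  then have "(\<lambda>n. q (X n)) \<longlonglongrightarrow> q z"
    unfolding q_def by (intro tendsto_diff tendsto_mult tendsto_inner tendsto_const z)
  moreover have "(\<lambda>n. m + inverse (real (Suc n))) \<longlonglongrightarrow> m"
    using tendsto_add[OF tendsto_const inv, of m] by simp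
  ultimately have "q z \<le> m"
    using X by (intro LIMSEQ_le) (auto intro: less_imp_le)
  have "f h = z \<bullet> h" if "h \<in> V" for h
  proof (cases "h = 0")
    case False
    \<comment> \<open>\<open>d\<close> is half the derivative of \<open>q\<close> at \<open>z\<close> along \<open>h\<close>; a step of \<open>- d / (h \<bullet> h)\<close> minimises \<open>q\<close> on that line.\<close>
    define d where "d = z \<bullet> h - f h"
    have along_line: "q (z + c *\<^sub>R h) = q z + 2 * c * d + c\<^sup>2 * (h \<bullet> h)" for c
      by (simp add: q_def d_def f.add f.scale inner_add_left inner_add_right inner_commute[of h z]
          algebra_simps power2_eq_square)
    have "h \<bullet> h > 0" using False by simp
    have "z + (- d / (h \<bullet> h)) *\<^sub>R h \<in> V"
      using that \<open>z \<in> V\<close> \<open>subspace V\<close> subspace_add subspace_scale by blast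
    then have "q z \<le> q (z + (- d / (h \<bullet> h)) *\<^sub>R h)" using m_le \<open>q z \<le> m\<close> by fastforce
    also have "\<dots> = q z + 2 * (- d / (h \<bullet> h)) * d + (- d / (h \<bullet> h))\<^sup>2 * (h \<bullet> h)"
      by (rule along_line)
    also have "\<dots> = q z - d\<^sup>2 / (h \<bullet> h)"
      using \<open>h \<bullet> h > 0\<close> by (simp add: field_simps power2_eq_square)
    finally have "d\<^sup>2 / (h \<bullet> h) \<le> 0" by simp
    then have "d = 0" using \<open>h \<bullet> h > 0\<close> by (simp add: divide_le_0_iff)
    then show ?thesis by (simp add: d_def)
  qed (simp add: f.zero)
  with \<open>z \<in> V\<close> show ?thesis by (rule that)
qed

lemma subspace_closure:
  fixes V :: "'a::real_normed_vector set"
  assumes "subspace V" shows "subspace (closure V)"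
proof (rule subspaceI)
  show "0 \<in> closure V" using closure_subset assms subspace_0 by blast
next
  fix x y assume "x \<in> closure V" "y \<in> closure V"
  then obtain X Y where "\<And>n::nat. X n \<in> V" "X \<longlonglongrightarrow> x" "\<And>n::nat. Y n \<in> V" "Y \<longlonglongrightarrow> y"
    unfolding closure_sequential by auto
  then show "x + y \<in> closure V"
    unfolding closure_sequential using assms
    by (intro exI[of _ "\<lambda>n. X n + Y n"]) (auto intro: tendsto_add subspace_add)
next
  fix c :: real and x assume "x \<in> closure V"
  then obtain X where "\<And>n::nat. X n \<in> V" "X \<longlonglongrightarrow> x"
    unfolding closure_sequential by auto
  then show "c *\<^sub>R x \<in> closure V"
    unfolding closure_sequential using assms
    by (intro exI[of _ "\<lambda>n. c *\<^sub>R X n"]) (auto intro: tendsto_scaleR subspace_scale)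
qed

text \<open>
  A point minus its projection to the closure of \<open>V\<close> is orthogonal to \<open>V\<close>, hence zero.
\<close>

lemma dense_subspaceI:
  fixes V :: "'a::{real_inner, complete_space} set"
  assumes "subspace V" and perp: "\<And>y. (\<And>h. h \<in> V \<Longrightarrow> y \<bullet> h = 0) \<Longrightarrow> y = 0"
  shows "closure V = UNIV"
proof -
  have "p \<in> closure V" for p
  proof -
    have "linear (\<lambda>h. p \<bullet> h)" by (simp add: bounded_linear.linear bounded_linear_inner_right)
    moreover have "\<bar>p \<bullet> h\<bar> \<le> norm p * norm h" for h by (rule Cauchy_Schwarz_ineq2)
    ultimately obtain z where "z \<in> closure V" and z: "\<And>h. h \<in> closure V \<Longrightarrow> p \<bullet> h = z \<bullet> h"
      using riesz_on_closed_subspace[OF _ _ closed_closure subspace_closure[OF assms(1)]] by blast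
    then have "p - z = 0"
      using closure_subset by (intro perp) (auto simp: inner_diff_left)
    with \<open>z \<in> closure V\<close> show ?thesis by simp
  qed
  then show ?thesis by auto
qed

section \<open>Characteristic functionals determine finite Borel measures\<close>

text \<open>
  The value of \<^const>\<open>char\<close> at \<open>0\<close> is the total mass, so both measures can be normalised by the same
  constant and Levy's theorem for probability measures applies.
\<close>

lemma finite_measure_eqI_char:
  fixes M N :: "real measure"
  assumes "finite_measure M" "finite_measure N" and [measurable_cong, simp]: "sets M = sets borel" "sets N = sets borel"
    and char: "char M = char N"
  shows "M = N"
proof -
  interpret M: finite_measure M by fact
  interpret N: finite_measure N by fact
  have [simp]: "space M = UNIV" "space N = UNIV"
    using sets_eq_imp_space_eq[OF assms(3)] sets_eq_imp_space_eq[OF assms(4)] by simp_all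
  define m where "m = measure M UNIV"
  have "m = measure N UNIV"
    using fun_cong[OF char, of 0] by (simp add: char_def m_def)
  show ?thesis
  proof (cases "m = 0")
    case True
    then have "emeasure M A = emeasure N A" if "A \<in> sets borel" for A
      using that \<open>m = measure N UNIV\<close> M.finite_measure_mono[of A UNIV] N.finite_measure_mono[of A UNIV]
      by (simp add: m_def M.emeasure_eq_measure N.emeasure_eq_measure) (metis measure_nonneg order_antisym)
    then show ?thesis by (intro measure_eqI) auto
  next
    case False
    then have "m > 0" by (simp add: m_def order_less_le)
    have norm_real: "real_distribution (density L (\<lambda>_. ennreal (1 / m)))"
      if "finite_measure L" "measure L UNIV = m" "sets L = sets borel" for L :: "real measure"
    proof -
      interpret L: finite_measure L by fact
      have [simp]: "space L = UNIV" using that(3) sets_eq_imp_space_eq[of _ borel] by auto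
      have "emeasure (density L (\<lambda>_. ennreal (1 / m))) UNIV = 1"
        using \<open>m > 0\<close> sets.top[of L] that(2)
        by (simp add: emeasure_density L.emeasure_eq_measure ennreal_mult[symmetric])
      then show ?thesis using that(3)
        by (auto simp: real_distribution_def real_distribution_axioms_def intro!: prob_spaceI)
    qed
    have norm_char: "char (density L (\<lambda>_. ennreal (1 / m))) t = complex_of_real (1 / m) * char L t"
      if [measurable_cong]: "sets L = sets borel" for L :: "real measure" and t
      using \<open>m > 0\<close> unfolding char_def
      by (subst integral_density) (auto simp: scaleR_conv_of_real)
    have eq: "density M (\<lambda>_. ennreal (1 / m)) = density N (\<lambda>_. ennreal (1 / m))"
      using \<open>m = measure N UNIV\<close> assms norm_char
      by (intro Levy_uniqueness norm_real) (auto simp: m_def)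
    have "emeasure M A = emeasure N A" if "A \<in> sets borel" for A
    proof -
      have "ennreal (1/m) * emeasure M A = ennreal (1/m) * emeasure N A"
        using arg_cong[OF eq, of "\<lambda>L. emeasure L A"] that by (simp add: emeasure_density nn_integral_cmult_indicator)
      then show ?thesis using \<open>m > 0\<close> by (simp add: ennreal_mult_cancel_left)
    qed
    then show ?thesis by (intro measure_eqI) auto
  qed
qed

lemma integrable_weighted_iexp:
  fixes g :: "'a::{real_inner, second_countable_topology} \<Rightarrow> real"
  assumes "finite_measure P" and [measurable_cong]: "sets P = sets borel"
    and [measurable]: "g \<in> borel_measurable borel" and bd: "\<And>z. \<bar>g z\<bar> \<le> b"
  shows "integrable P (\<lambda>z. g z *\<^sub>R iexp (y \<bullet> z))"
proof (rule finite_measure.integrable_const_bound[OF assms(1), of _ b])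
  show "AE x in P. cmod (g x *\<^sub>R iexp (y \<bullet> x)) \<le> b"
    using bd by (intro AE_I2) (simp add: norm_mult)
qed measurable

text \<open>
  A nonnegative weight \<open>h\<close> turns \<open>P\<close> into a finite measure, whose image under \<open>(\<bullet>) x\<close> is a measure on
  the line; the hypothesis says that the two images have the same characteristic function.
\<close>

lemma integral_cylinder_eq:
  fixes P Q :: "'a::{real_inner, second_countable_topology} measure"
  assumes "finite_measure P" "finite_measure Q"
    and [measurable_cong]: "sets P = sets borel" "sets Q = sets borel"
    and [measurable]: "h \<in> borel_measurable borel" and h: "\<And>z. 0 \<le> h z" "\<And>z. h z \<le> b"
    and eq: "\<And>t. (CLINT z|P. h z *\<^sub>R iexp (t * (x \<bullet> z))) = (CLINT z|Q. h z *\<^sub>R iexp (t * (x \<bullet> z)))"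
    and [measurable]: "A \<in> sets borel"
  shows "(LINT z|P. h z * indicator A (x \<bullet> z)) = (LINT z|Q. h z * indicator A (x \<bullet> z))"
proof -
  define D where "D M = distr (density M h) borel (\<lambda>z. x \<bullet> z)" for M :: "'a measure"
  have fin: "finite_measure (D M)" if "finite_measure M" and [measurable_cong]: "sets M = sets borel" for M
  proof -
    have "integrable M h"
      using h by (intro finite_measure.integrable_const_bound[OF that(1), of _ b]) (auto simp: abs_le_iff intro: order_trans[of _ 0])
    then have "finite_measure (density M h)"
      using h by (intro finite_measureI) (simp add: emeasure_density nn_integral_eq_integral cong: nn_integral_cong)
    then show ?thesis
      unfolding D_def by (intro finite_measure.finite_measure_distr) auto
  qed
  have D_char: "char (D M) t = (CLINT z|M. h z *\<^sub>R iexp (t * (x \<bullet> z)))"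
    if [measurable_cong]: "sets M = sets borel" for M t
    unfolding char_def D_def using h
    by (subst integral_distr) (auto simp: integral_density)
  have D_meas: "measure (D M) A = (LINT z|M. h z * indicator A (x \<bullet> z))"
    if "finite_measure M" and [measurable_cong]: "sets M = sets borel" for M
  proof -
    interpret D: finite_measure "D M" using fin that by auto
    have "measure (D M) A = (LINT s|D M. indicator A s)" by (simp add: D_def)
    also have "\<dots> = (LINT z|M. h z * indicator A (x \<bullet> z))"
      unfolding D_def using h
      by (subst integral_distr) (auto simp: integral_density)
    finally show ?thesis .
  qed
  have "D P = D Q"
  proof (rule finite_measure_eqI_char)
    show "char (D P) = char (D Q)"
      by (rule ext) (simp only: D_char[OF assms(3)] D_char[OF assms(4)] eq)
  qed (use assms fin in \<open>auto simp: D_def\<close>)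
  then show ?thesis using D_meas assms by metis
qed

text \<open>
  This step replaces the uniqueness theorem for characteristic functions in several dimensions: equality of
  the weighted characteristic functionals survives restriction to a set that depends on one coordinate
  \<open>x \<bullet> z\<close> only, so that any finite number of coordinates can be treated one after the other. The factor
  \<open>iexp (y \<bullet> z)\<close> is not a nonnegative weight, but \<open>1 + cos (y \<bullet> z)\<close> and \<open>1 + sin (y \<bullet> z)\<close> are, and
  integrating \<open>iexp (t * (x \<bullet> z))\<close> against them only involves the weighted characteristic functionals at
  \<open>t *\<^sub>R x\<close> and \<open>t *\<^sub>R x \<plusminus> y\<close>.
\<close>

lemma weighted_char_restrict:
  fixes P Q :: "'a::{real_inner, second_countable_topology} measure"
  assumes fin: "finite_measure P" "finite_measure Q"
    and sets[measurable_cong]: "sets P = sets borel" "sets Q = sets borel"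
    and g[measurable]: "g \<in> borel_measurable borel" and g01: "\<And>z. 0 \<le> g z" "\<And>z. g z \<le> 1"
    and eq: "\<And>y. (CLINT z|P. g z *\<^sub>R iexp (y \<bullet> z)) = (CLINT z|Q. g z *\<^sub>R iexp (y \<bullet> z))"
    and A[measurable]: "A \<in> sets borel"
  shows "(CLINT z|P. (g z * indicator A (x \<bullet> z)) *\<^sub>R iexp (y \<bullet> z)) =
         (CLINT z|Q. (g z * indicator A (x \<bullet> z)) *\<^sub>R iexp (y \<bullet> z))"
proof -
  have int: "integrable M (\<lambda>z. g z *\<^sub>R iexp (v \<bullet> z))"
    if "finite_measure M" "sets M = sets borel" for M v
    using that g01 by (intro integrable_weighted_iexp[where b=1]) (auto simp: abs_le_iff intro: order_trans[of _ 0])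
  \<comment> \<open>The phase \<open>c\<close> treats both weights at once: \<open>c = 1\<close> gives the cosine and \<open>c = - \<i>\<close> the sine.\<close>
  define R where "R c z = Re (c * iexp (y \<bullet> z))" for c z
  have [measurable]: "R c \<in> borel_measurable borel" for c unfolding R_def by measurable
  have Rle: "\<bar>R c z\<bar> \<le> 1" if "cmod c = 1" for c z
    using abs_Re_le_cmod[of "c * iexp (y \<bullet> z)"] that by (simp add: R_def norm_mult)
  have g_half: "(LINT z|P. g z * indicator A (x \<bullet> z)) = (LINT z|Q. g z * indicator A (x \<bullet> z))"
    using eq[of "_ *\<^sub>R x"] by (intro integral_cylinder_eq[OF fin sets g g01 _ A]) simp
  have R_half: "(LINT z|P. (g z * (1 + R c z)) * indicator A (x \<bullet> z)) = (LINT z|Q. (g z * (1 + R c z)) * indicator A (x \<bullet> z))"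
    if c: "cmod c = 1" for c
  proof (rule integral_cylinder_eq[OF fin sets _ _ _ _ A, where b=2])
    show "(\<lambda>z. g z * (1 + R c z)) \<in> borel_measurable borel" by measurable
    have "0 \<le> 1 + R c z" "1 + R c z \<le> 2" for z using Rle[OF c, of z] by auto
    then show "0 \<le> g z * (1 + R c z)" "g z * (1 + R c z) \<le> 2" for z
      using g01[of z] mult_mono[of "g z" 1 "1 + R c z" 2] by auto
    fix t
    have expand: "(CLINT z|M. (g z * (1 + R c z)) *\<^sub>R iexp (t * (x \<bullet> z))) =
        (CLINT z|M. g z *\<^sub>R iexp ((t *\<^sub>R x) \<bullet> z)) + c / 2 * (CLINT z|M. g z *\<^sub>R iexp ((t *\<^sub>R x + y) \<bullet> z))
        + cnj c / 2 * (CLINT z|M. g z *\<^sub>R iexp ((t *\<^sub>R x - y) \<bullet> z))"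
      if M: "finite_measure M" "sets M = sets borel" for M
    proof -
      have R_eq: "complex_of_real (R c z) = (c * iexp (y \<bullet> z) + cnj c * iexp (- (y \<bullet> z))) / 2" for z
        by (simp add: R_def complex_eq_iff Re_exp Im_exp)
      have "(g z * (1 + R c z)) *\<^sub>R iexp (t * (x \<bullet> z)) = g z *\<^sub>R iexp ((t *\<^sub>R x) \<bullet> z)
        + c / 2 * (g z *\<^sub>R iexp ((t *\<^sub>R x + y) \<bullet> z)) + cnj c / 2 * (g z *\<^sub>R iexp ((t *\<^sub>R x - y) \<bullet> z))" for z
      proof -
        have "iexp ((t *\<^sub>R x + y) \<bullet> z) = iexp (t * (x \<bullet> z)) * iexp (y \<bullet> z)"
          "iexp ((t *\<^sub>R x - y) \<bullet> z) = iexp (t * (x \<bullet> z)) * iexp (- (y \<bullet> z))"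
          by (simp_all add: inner_add_left inner_diff_left algebra_simps flip: exp_add)
        then show ?thesis
          unfolding scaleR_conv_of_real of_real_mult of_real_add R_eq by (simp add: algebra_simps add_divide_distrib)
      qed
      then have "has_bochner_integral M (\<lambda>z. (g z * (1 + R c z)) *\<^sub>R iexp (t * (x \<bullet> z)))
        ((CLINT z|M. g z *\<^sub>R iexp ((t *\<^sub>R x) \<bullet> z)) + c / 2 * (CLINT z|M. g z *\<^sub>R iexp ((t *\<^sub>R x + y) \<bullet> z))
        + cnj c / 2 * (CLINT z|M. g z *\<^sub>R iexp ((t *\<^sub>R x - y) \<bullet> z)))"
        by (simp only:) (intro has_bochner_integral_add has_bochner_integral_mult_right
            has_bochner_integral_integrable int[OF M])
      then show ?thesis by (rule has_bochner_integral_integral_eq)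
    qed
    show "(CLINT z|P. (g z * (1 + R c z)) *\<^sub>R iexp (t * (x \<bullet> z))) = (CLINT z|Q. (g z * (1 + R c z)) *\<^sub>R iexp (t * (x \<bullet> z)))"
      by (simp only: expand[OF fin(1) sets(1)] expand[OF fin(2) sets(2)] eq)
  qed
  define G where "G z = g z * indicator A (x \<bullet> z)" for z
  have [measurable]: "G \<in> borel_measurable borel" unfolding G_def by measurable
  have Gb: "\<bar>G z\<bar> \<le> 1" for z using g01[of z] by (auto simp: G_def indicator_def)
  have intG: "integrable M (\<lambda>z. G z *\<^sub>R iexp (y \<bullet> z))" "integrable M (\<lambda>z. G z)" "integrable M (\<lambda>z. G z * R c z)"
    if M: "finite_measure M" and [measurable_cong]: "sets M = sets borel" and c: "cmod c = 1" for M c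
  proof -
    show "integrable M (\<lambda>z. G z *\<^sub>R iexp (y \<bullet> z))" using M that(2) Gb by (intro integrable_weighted_iexp) auto
    show "integrable M G" using Gb by (intro finite_measure.integrable_const_bound[OF M, of _ 1]) auto
    show "integrable M (\<lambda>z. G z * R c z)"
      using mult_mono[OF Gb Rle[OF c]] by (intro finite_measure.integrable_const_bound[OF M, of _ 1]) (auto simp: abs_mult)
  qed
  have GR: "(LINT z|P. G z * R c z) = (LINT z|Q. G z * R c z)" if c: "cmod c = 1" for c
  proof -
    have "(LINT z|M. (g z * (1 + R c z)) * indicator A (x \<bullet> z)) = (LINT z|M. G z) + (LINT z|M. G z * R c z)"
      if M: "finite_measure M" "sets M = sets borel" for M
    proof -
      have "(g z * (1 + R c z)) * indicator A (x \<bullet> z) = G z + G z * R c z" for z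
        by (simp add: G_def algebra_simps)
      then show ?thesis
        by (simp only:) (intro Bochner_Integration.integral_add intG[OF M c])
    qed
    then show ?thesis using R_half[OF c] g_half fin sets by (simp add: G_def)
  qed
  have "Re (c * (CLINT z|P. G z *\<^sub>R iexp (y \<bullet> z))) = Re (c * (CLINT z|Q. G z *\<^sub>R iexp (y \<bullet> z)))" if c: "cmod c = 1" for c
  proof -
    have "Re (c * (CLINT z|M. G z *\<^sub>R iexp (y \<bullet> z))) = (LINT z|M. G z * R c z)"
      if M: "finite_measure M" "sets M = sets borel" for M
    proof -
      have "Re (CLINT z|M. c * (G z *\<^sub>R iexp (y \<bullet> z))) = (LINT z|M. Re (c * (G z *\<^sub>R iexp (y \<bullet> z))))"
        by (intro integral_Re[symmetric] integrable_mult_right intG(1)[OF M c])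
      also have "\<dots> = (LINT z|M. G z * R c z)"
        unfolding R_def by (simp only: mult_scaleR_right scaleR_complex.simps)
      finally show ?thesis by (simp only: integral_mult_right_zero)
    qed
    then show ?thesis using GR[OF c] fin sets by simp
  qed
  from this[of 1] this[of "- \<i>"] show ?thesis unfolding G_def[symmetric] by (simp add: complex_eq_iff)
qed

definition halfspace_intersections :: "'a::real_inner set set" where
  "halfspace_intersections = {(\<Inter>(x, c)\<in>I. {z. x \<bullet> z \<le> c}) | I. finite I}"

text \<open>
  By separability a closed ball is a countable intersection of half-spaces, namely of the conditions
  \<open>d \<bullet> (z - a) \<le> r * norm d\<close> with \<open>d\<close> in a countable dense set, and an open set is a countable union of balls.
\<close>

lemma borel_eq_halfspace_intersections:
  "sets (borel :: 'a::{real_inner, second_countable_topology} measure) = sigma_sets UNIV halfspace_intersections"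
proof (rule antisym)
  let ?\<Sigma> = "sigma UNIV (halfspace_intersections :: 'a set set)"
  have half: "{z. x \<bullet> z \<le> c} \<in> sets ?\<Sigma>" for x :: 'a and c
  proof -
    have "{z. x \<bullet> z \<le> c} = (\<Inter>(x, c)\<in>{(x, c)}. {z. x \<bullet> z \<le> c})" by simp
    then have "{z. x \<bullet> z \<le> c} \<in> halfspace_intersections"
      unfolding halfspace_intersections_def by blast
    then show ?thesis by auto
  qed
  obtain D :: "'a set" where "countable D" and D: "\<And>U. open U \<Longrightarrow> U \<noteq> {} \<Longrightarrow> \<exists>d\<in>D. d \<in> U"
    using countable_dense_setE by blast
  have "D \<noteq> {}" using D[of UNIV] by auto
  have cball_eq: "cball a r = (\<Inter>d\<in>D. {z. d \<bullet> z \<le> d \<bullet> a + r * norm d})" if "r \<ge> 0" for a :: 'a and r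
  proof -
    have "z \<in> cball a r \<longleftrightarrow> (\<forall>d\<in>D. d \<bullet> (z - a) \<le> r * norm d)" for z
    proof
      assume "z \<in> cball a r"
      then show "\<forall>d\<in>D. d \<bullet> (z - a) \<le> r * norm d"
        by (metis dist_commute dist_norm mem_cball mult.commute mult_right_mono norm_cauchy_schwarz norm_ge_zero order_trans)
    next
      assume all: "\<forall>d\<in>D. d \<bullet> (z - a) \<le> r * norm d"
      show "z \<in> cball a r"
      proof (rule ccontr)
        assume "z \<notin> cball a r"
        then have gt: "r < norm (z - a)" by (simp add: dist_norm norm_minus_commute)
        \<comment> \<open>The inequality fails at \<open>d = z - a\<close>, hence on an open set of \<open>d\<close>.\<close>
        have "open {d. r * norm d < d \<bullet> (z - a)}"
          by (intro open_Collect_less continuous_intros)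
        moreover have "0 < norm (z - a)" using gt \<open>r \<ge> 0\<close> by linarith
        then have "r * norm (z - a) < (z - a) \<bullet> (z - a)"
          using mult_strict_right_mono[OF gt, of "norm (z - a)"]
          by (simp add: dot_square_norm power2_eq_square)
        ultimately obtain d where "d \<in> D" "r * norm d < d \<bullet> (z - a)" using D by blast
        then show False using all by force
      qed
    qed
    then show ?thesis by (auto simp: inner_diff_right algebra_simps)
  qed
  have cball: "cball a r \<in> sets ?\<Sigma>" if "r \<ge> 0" for a :: 'a and r
    unfolding cball_eq[OF that] using \<open>countable D\<close> \<open>D \<noteq> {}\<close> half by (intro sets.countable_INT') auto
  have "U \<in> sets ?\<Sigma>" if "open U" for U :: "'a set"
  proof -
    define R where "R = {(a, r). 0 < r \<and> cball a r \<subseteq> U}"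
    let ?ball = "\<lambda>(a, r). ball a r" and ?cball = "\<lambda>(a, r). cball a r"
    have "U \<subseteq> \<Union>(?ball ` R)"
    proof
      fix a assume "a \<in> U"
      then obtain r where "r > 0" "cball a r \<subseteq> U" using \<open>open U\<close> open_contains_cball by blast
      then have "(a, r) \<in> R" "a \<in> ball a r" by (simp_all add: R_def)
      then show "a \<in> \<Union>(?ball ` R)" by blast
    qed
    obtain F' where F': "F' \<subseteq> ?ball ` R" "countable F'" "\<Union>F' = \<Union>(?ball ` R)"
      by (rule Lindelof[of "?ball ` R"]) auto
    obtain R' where R': "countable R'" "R' \<subseteq> R" "F' = ?ball ` R'"
      using F' countable_subset_image by metis
    have "U \<subseteq> \<Union>(?ball ` R')" using \<open>U \<subseteq> \<Union>(?ball ` R)\<close> F'(3) R'(3) by simp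
    also have "\<dots> \<subseteq> \<Union>(?cball ` R')" using ball_subset_cball by fast
    finally have "U = \<Union>(?cball ` R')" using R'(2) by (force simp: R_def)
    also have "\<dots> \<in> sets ?\<Sigma>"
    proof (rule sets.countable_UN''[OF R'(1)])
      fix p assume "p \<in> R'"
      then obtain a r where "p = (a, r)" "0 < r" using R'(2) by (auto simp: R_def)
      then show "?cball p \<in> sets ?\<Sigma>" using cball[of r a] by simp
    qed
    finally show ?thesis .
  qed
  then show "sets (borel :: 'a measure) \<subseteq> sigma_sets UNIV halfspace_intersections"
    unfolding sets_borel by (intro sigma_sets_mono) auto
next
  have "A \<in> sets borel" if A: "A \<in> halfspace_intersections" for A :: "'a set"
  proof -
    obtain I where "finite I" "A = (\<Inter>(x, c)\<in>I. {z. x \<bullet> z \<le> c})"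
      using A by (auto simp: halfspace_intersections_def)
    then show ?thesis
      by (auto intro!: borel_closed closed_INT closed_Collect_le continuous_intros)
  qed
  then show "sigma_sets UNIV halfspace_intersections \<subseteq> sets (borel :: 'a measure)"
    by (intro sets.sigma_sets_subset'[where M=borel, simplified]) auto
qed

text \<open>
  Finite intersections of half-spaces form an intersection-stable generator of the Borel sets. Restricting to
  one half-space after the other keeps the characteristic functionals equal; at \<open>y = 0\<close> this says that both
  measures give the intersection the same mass.
\<close>

theorem finite_borel_measure_eqI_char_functional:
  fixes P Q :: "'a::{real_inner, second_countable_topology} measure"
  assumes fin: "finite_measure P" "finite_measure Q"
    and sets: "sets P = sets borel" "sets Q = sets borel"
    and eq: "\<And>y. (CLINT z|P. iexp (y \<bullet> z)) = (CLINT z|Q. iexp (y \<bullet> z))"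
  shows "P = Q"
proof (rule measure_eqI_generator_eq[where E=halfspace_intersections and \<Omega>=UNIV and A="\<lambda>_. UNIV"])
  interpret P: finite_measure P by fact
  interpret Q: finite_measure Q by fact
  show "Int_stable (halfspace_intersections :: 'a set set)"
  proof (rule Int_stableI)
    fix A B :: "'a set" assume "A \<in> halfspace_intersections" "B \<in> halfspace_intersections"
    then obtain I J where "finite I" "A = (\<Inter>(x, c)\<in>I. {z. x \<bullet> z \<le> c})" "finite J" "B = (\<Inter>(x, c)\<in>J. {z. x \<bullet> z \<le> c})"
      unfolding halfspace_intersections_def by auto
    then show "A \<inter> B \<in> halfspace_intersections"
      unfolding halfspace_intersections_def by (auto simp: INT_Un intro!: exI[of _ "I \<union> J"])
  qed
  show "emeasure P X = emeasure Q X" if X: "X \<in> halfspace_intersections" for X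
  proof -
    obtain I where "finite I" and X_eq: "X = (\<Inter>(x, c)\<in>I. {z. x \<bullet> z \<le> c})"
      using X by (auto simp: halfspace_intersections_def)
    define T where "T J = (\<Inter>(x, c)\<in>J. {z :: 'a. x \<bullet> z \<le> c})" for J
    have T[measurable]: "T J \<in> sets borel" for J
      unfolding T_def by (auto intro!: borel_closed closed_INT closed_Collect_le continuous_intros)
    have "(CLINT z|P. indicator (T I) z *\<^sub>R iexp (y \<bullet> z)) = (CLINT z|Q. indicator (T I) z *\<^sub>R iexp (y \<bullet> z))" for y
      using \<open>finite I\<close>
    proof (induction I arbitrary: y)
      case empty
      then show ?case using eq by (simp add: T_def)
    next
      case (insert i I)
      obtain x c where i: "i = (x, c)" by fastforce
      have "indicator (T (insert i I)) z = indicator (T I) z * (indicator {..c} (x \<bullet> z) :: real)" for z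
        by (auto simp: T_def i indicator_def)
      then show ?case
        using weighted_char_restrict[OF fin sets _ _ _ insert.IH, of "{..c}" x y] T by simp
    qed
    from this[of 0] have "complex_of_real (measure P (T I)) = complex_of_real (measure Q (T I))"
      using sets T sets_eq_imp_space_eq[OF sets(1)] sets_eq_imp_space_eq[OF sets(2)]
      by (simp add: scaleR_conv_of_real)
    then show ?thesis using X_eq by (simp add: T_def P.emeasure_eq_measure Q.emeasure_eq_measure)
  qed
  have "UNIV \<in> (halfspace_intersections :: 'a set set)"
    unfolding halfspace_intersections_def by (auto intro!: exI[of _ "{}"])
  then show "range (\<lambda>_::nat. UNIV) \<subseteq> (halfspace_intersections :: 'a set set)" by auto
  show "emeasure P UNIV \<noteq> \<infinity>" by (simp add: P.emeasure_finite)
qed (use sets borel_eq_halfspace_intersections in auto)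

lemma borel_prob_eqI_char_functional:
  assumes "borel_prob P" "borel_prob Q" "char_functional P = char_functional Q"
  shows "P = Q"
proof (rule finite_borel_measure_eqI_char_functional)
  show "(CLINT z|P. iexp (y \<bullet> z)) = (CLINT z|Q. iexp (y \<bullet> z))" for y
    using fun_cong[OF assms(3), of y] unfolding char_functional_def .
qed (use assms in \<open>simp_all add: borel_prob_def prob_space_def\<close>)

lemma continuous_char_functional:
  assumes "borel_prob P"
  shows "continuous_on UNIV (char_functional P)"
proof -
  interpret prob_space P using assms by (simp add: borel_prob_def)
  have [measurable_cong]: "sets P = sets borel" using assms by (simp add: borel_prob_def)
  have "(\<lambda>n. char_functional P (X n)) \<longlonglongrightarrow> char_functional P x" if X: "X \<longlonglongrightarrow> x" for X x
    unfolding char_functional_def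
  proof (rule integral_dominated_convergence[where w="\<lambda>_. 1"])
    show "AE z in P. (\<lambda>n. iexp (X n \<bullet> z)) \<longlonglongrightarrow> iexp (x \<bullet> z)"
      by (intro AE_I2 tendsto_exp tendsto_mult tendsto_of_real tendsto_inner tendsto_const X)
  qed auto
  then show ?thesis by (simp add: continuous_on_sequentially o_def)
qed

section \<open>Normal distributions on the line\<close>

lemma has_bochner_integral_return:
  fixes f :: "'b::topological_space \<Rightarrow> 'c::{banach, second_countable_topology}"
  assumes [measurable]: "f \<in> borel_measurable borel"
  shows "has_bochner_integral (return borel z) f (f z)"
proof -
  have "integrable (return borel z) f"
    unfolding integrable_iff_bounded by (subst nn_integral_return) auto
  moreover have "(LINT x|return borel z. f x) = f z"
    by (rule integral_return) auto
  ultimately show ?thesis unfolding has_bochner_integral_iff by blast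
qed

lemma has_bochner_integral_normal_distribution_mean:
  assumes "0 \<le> \<sigma>"
  shows "has_bochner_integral (normal_distribution \<mu> \<sigma>) (\<lambda>s. s) \<mu>"
proof (cases "\<sigma> = 0")
  case True
  have "has_bochner_integral (return borel \<mu>) (\<lambda>s. s) \<mu>"
    by (rule has_bochner_integral_return) auto
  then show ?thesis unfolding normal_distribution_def True by simp
next
  case False
  then have "has_bochner_integral lborel (\<lambda>s. normal_density \<mu> \<sigma> s *\<^sub>R s) \<mu>"
    using normal_moment_nz_1[of \<sigma> \<mu>] assms by simp
  then have "has_bochner_integral (density lborel (normal_density \<mu> \<sigma>)) (\<lambda>s. s) \<mu>"
    by (intro has_bochner_integral_density) auto
  then show ?thesis using False unfolding normal_distribution_def by simp
qed

lemma has_bochner_integral_normal_distribution_square: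
  assumes "0 \<le> \<sigma>"
  shows "has_bochner_integral (normal_distribution 0 \<sigma>) (\<lambda>s. s\<^sup>2) (\<sigma>\<^sup>2)"
proof (cases "\<sigma> = 0")
  case True
  have "has_bochner_integral (return borel 0) (\<lambda>s::real. s\<^sup>2) (0\<^sup>2)"
    by (rule has_bochner_integral_return) auto
  then show ?thesis unfolding normal_distribution_def True by simp
next
  case False
  then have "has_bochner_integral lborel (\<lambda>s. normal_density 0 \<sigma> s *\<^sub>R s\<^sup>2) (\<sigma>\<^sup>2)"
    using normal_moment_even[of \<sigma> 0 1] assms by simp
  then have "has_bochner_integral (density lborel (normal_density 0 \<sigma>)) (\<lambda>s. s\<^sup>2) (\<sigma>\<^sup>2)"
    by (intro has_bochner_integral_density) auto
  then show ?thesis using False unfolding normal_distribution_def by simp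
qed

text \<open>
  A centred normal variable is \<open>\<sigma>\<close> times a standard one.
\<close>

lemma char_normal_distribution:
  assumes "0 \<le> \<sigma>"
  shows "char (normal_distribution 0 \<sigma>) t = exp (- ((\<sigma> * t)\<^sup>2) / 2)"
proof (cases "\<sigma> = 0")
  case True
  then show ?thesis by (simp add: normal_distribution_def char_def integral_return)
next
  case False
  interpret std: prob_space std_normal_distribution
    using prob_space_normal_density by simp
  have "distributed std_normal_distribution lborel (\<lambda>x. x) std_normal_density"
    by (simp add: distributed_def distr_id2)
  from std.normal_density_affine[OF this, of \<sigma> 0]
  have "distr std_normal_distribution lborel (\<lambda>x. \<sigma> * x) = normal_distribution 0 \<sigma>"
    using False assms by (simp add: distributed_def normal_distribution_def)
  then have "char (normal_distribution 0 \<sigma>) t = char (distr std_normal_distribution lborel (\<lambda>x. \<sigma> * x)) t"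
    by simp
  also have "\<dots> = char std_normal_distribution (\<sigma> * t)"
    unfolding char_def by (subst integral_distr) (auto simp: mult_ac)
  finally show ?thesis by (simp add: char_std_normal_distribution)
qed

lemma open_null_normal_distribution:
  assumes "0 < \<sigma>" "open V" "AE s in normal_distribution \<mu> \<sigma>. s \<notin> V"
  shows "V = {}"
proof (rule ccontr)
  assume "V \<noteq> {}"
  then obtain v e where "e > 0" and e: "{v - e<..<v + e} \<subseteq> V"
    using \<open>open V\<close> by (metis ball_eq_greaterThanLessThan ex_in_conv open_contains_ball)
  have "normal_distribution \<mu> \<sigma> = density lborel (normal_density \<mu> \<sigma>)"
    using assms(1) by (simp add: normal_distribution_def)
  note assms(3)[unfolded this]
  then have "AE s in lborel. s \<notin> V"
    by (subst (asm) AE_density) (auto simp: normal_density_pos assms(1))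
  then have "AE s in lborel. s \<notin> {v - e<..<v + e}" 
    by (rule eventually_mono) (use e in blast)
  then have "emeasure lborel {v - e<..<v + e} = 0"
    by (subst (asm) AE_iff_measurable[of "{v - e<..<v + e}"]) auto
  then show False using \<open>e > 0\<close> by simp
qed

section \<open>Second moments of a centred Gaussian measure\<close>

lemma borel_measurable_inner_left[measurable]:
  "(\<lambda>w. x \<bullet> w) \<in> borel_measurable (borel :: 'a::real_inner measure)"
  by (intro borel_measurable_continuous_onI continuous_intros)

definition second_moment :: "'a::{real_inner, polish_space} measure \<Rightarrow> 'a \<Rightarrow> 'a \<Rightarrow> real" where
  "second_moment \<nu> x y = (LINT w|\<nu>. (x \<bullet> w) * (y \<bullet> w))"

locale centered_gaussian =
  fixes \<nu> :: "'a::{real_inner, polish_space} measure"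
  assumes gaussian: "gaussian \<nu>" and mean_zero: "is_mean \<nu> 0"
begin

lemma borel_prob: "borel_prob \<nu>"
  using gaussian by (simp add: gaussian_def)

sublocale prob_space \<nu>
  using borel_prob by (simp add: borel_prob_def)

lemma sets_eq[measurable_cong, simp]: "sets \<nu> = sets borel"
  using borel_prob by (simp add: borel_prob_def)

lemma space_eq[simp]: "space \<nu> = UNIV"
  using sets_eq_imp_space_eq[OF sets_eq] by simp

lemma marginal_normal:
  obtains \<sigma> where "0 \<le> \<sigma>" and "distr \<nu> borel (\<lambda>w. x \<bullet> w) = normal_distribution 0 \<sigma>"
proof -
  obtain \<mu> \<sigma> where "0 \<le> \<sigma>" and D: "distr \<nu> borel (\<lambda>w. x \<bullet> w) = normal_distribution \<mu> \<sigma>"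
    using gaussian unfolding gaussian_def by meson
  have "has_bochner_integral (distr \<nu> borel (\<lambda>w. x \<bullet> w)) (\<lambda>s. s) 0"
    using mean_zero by (intro has_bochner_integral_distr) (auto simp: is_mean_def inner_commute)
  then have "\<mu> = 0"
    using has_bochner_integral_normal_distribution_mean[OF \<open>0 \<le> \<sigma>\<close>] D has_bochner_integral_eq by metis
  with \<open>0 \<le> \<sigma>\<close> D show ?thesis by (intro that) auto
qed

lemma has_bochner_integral_square:
  assumes "distr \<nu> borel (\<lambda>w. x \<bullet> w) = normal_distribution 0 \<sigma>" "0 \<le> \<sigma>"
  shows "has_bochner_integral \<nu> (\<lambda>w. (x \<bullet> w)\<^sup>2) (\<sigma>\<^sup>2)"
proof -
  have "has_bochner_integral (distr \<nu> borel (\<lambda>w. x \<bullet> w)) (\<lambda>s. s\<^sup>2) (\<sigma>\<^sup>2)"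
    unfolding assms(1) by (rule has_bochner_integral_normal_distribution_square[OF assms(2)])
  then show ?thesis
    by (simp add: has_bochner_integral_iff integrable_distr_eq integral_distr)
qed

lemma integrable_product: "integrable \<nu> (\<lambda>w. (x \<bullet> w) * (y \<bullet> w))"
proof (rule Bochner_Integration.integrable_bound)
  have "integrable \<nu> (\<lambda>w. (v \<bullet> w)\<^sup>2)" for v
  proof -
    obtain \<sigma> where "0 \<le> \<sigma>" "distr \<nu> borel (\<lambda>w. v \<bullet> w) = normal_distribution 0 \<sigma>"
      by (rule marginal_normal)
    then show ?thesis using has_bochner_integral_square integrable.intros by blast
  qed
  then show "integrable \<nu> (\<lambda>w. (x \<bullet> w)\<^sup>2 + (y \<bullet> w)\<^sup>2)" by simp
  have "\<bar>a * b\<bar> \<le> a\<^sup>2 + b\<^sup>2" for a b :: real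
  proof -
    have "2 * (\<bar>a\<bar> * \<bar>b\<bar>) \<le> a\<^sup>2 + b\<^sup>2" using sum_squares_bound[of "\<bar>a\<bar>" "\<bar>b\<bar>"] by simp
    moreover have "0 \<le> \<bar>a\<bar> * \<bar>b\<bar>" by simp
    ultimately show ?thesis unfolding abs_mult by linarith
  qed
  then show "AE w in \<nu>. norm ((x \<bullet> w) * (y \<bullet> w)) \<le> norm ((x \<bullet> w)\<^sup>2 + (y \<bullet> w)\<^sup>2)"
    by (intro AE_I2) simp
qed measurable

lemma has_bochner_second_moment: "has_bochner_integral \<nu> (\<lambda>w. (x \<bullet> w) * (y \<bullet> w)) (second_moment \<nu> x y)"
  using integrable_product by (simp add: second_moment_def has_bochner_integral_integrable)

lemma second_moment_commute: "second_moment \<nu> x y = second_moment \<nu> y x"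
  by (simp add: second_moment_def mult.commute)

lemma second_moment_add: "second_moment \<nu> x (y + z) = second_moment \<nu> x y + second_moment \<nu> x z"
  using integrable_product by (simp add: second_moment_def inner_add_left distrib_left)

lemma second_moment_scale: "second_moment \<nu> x (c *\<^sub>R y) = c * second_moment \<nu> x y"
  by (simp add: second_moment_def mult.left_commute)

lemma second_moment_diff: "second_moment \<nu> x (y - z) = second_moment \<nu> x y - second_moment \<nu> x z"
  using second_moment_add[of x y "(-1) *\<^sub>R z"] second_moment_scale[of x "-1" z] by simp

lemma second_moment_nonneg: "0 \<le> second_moment \<nu> x x"
  by (simp add: second_moment_def)

lemma marginal_eq: "distr \<nu> borel (\<lambda>w. x \<bullet> w) = normal_distribution 0 (sqrt (second_moment \<nu> x x))"
proof -
  obtain \<sigma> where s: "0 \<le> \<sigma>" "distr \<nu> borel (\<lambda>w. x \<bullet> w) = normal_distribution 0 \<sigma>"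
    by (rule marginal_normal)
  have "second_moment \<nu> x x = \<sigma>\<^sup>2"
    using has_bochner_integral_square[OF s(2,1)] has_bochner_second_moment[of x x] has_bochner_integral_eq
    by (fastforce simp: power2_eq_square)
  then show ?thesis using s by simp
qed

text \<open>
  This carries covariances over to laws: as characteristic functionals determine measures, an identity between
  quadratic forms becomes an identity between distributions.
\<close>

lemma char_functional_eq: "char_functional \<nu> x = exp (- (second_moment \<nu> x x) / 2)"
proof -
  have "char_functional \<nu> x = char (distr \<nu> borel (\<lambda>w. x \<bullet> w)) 1"
    unfolding char_functional_def char_def by (subst integral_distr) auto
  also have "\<dots> = exp (- (second_moment \<nu> x x) / 2)"
    unfolding marginal_eq by (subst char_normal_distribution) (auto simp: second_moment_nonneg exp_of_real[symmetric])
  finally show ?thesis .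
qed

text \<open>
  Boundedness comes from continuity of the characteristic functional at \<open>0\<close>: near \<open>0\<close> the value
  \<open>exp (- second_moment \<nu> y y / 2)\<close> exceeds \<open>1/2\<close>, so the variance of \<open>(\<bullet>) y\<close> is bounded on a ball, and so is
  the covariance with \<open>x\<close>, since the quadratic form is nonnegative at \<open>x + y\<close> and \<open>x - y\<close>.
\<close>

lemma second_moment_bounded:
  obtains K where "\<And>y. \<bar>second_moment \<nu> x y\<bar> \<le> K * norm y"
proof -
  have "char_functional \<nu> 0 = 1" by (simp add: char_functional_eq second_moment_def)
  moreover have "isCont (char_functional \<nu>) 0"
    using continuous_char_functional[OF borel_prob] continuous_on_eq_continuous_at by blast
  ultimately obtain \<delta> where "\<delta> > 0" and \<delta>: "\<And>y. norm y < \<delta> \<Longrightarrow> cmod (char_functional \<nu> y - 1) < 1/2"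
    unfolding continuous_at_eps_delta by (metis dist_norm diff_zero half_gt_zero zero_less_one)
  have small: "second_moment \<nu> y y < 2" if "norm y < \<delta>" for y
  proof -
    have "1/2 < exp (- (second_moment \<nu> y y) / 2)"
      using \<delta>[OF that] abs_Re_le_cmod[of "char_functional \<nu> y - 1"]
      by (simp add: char_functional_eq)
    then have "exp (second_moment \<nu> y y / 2) < 2"
      by (simp add: exp_minus field_simps)
    then show ?thesis using exp_ge_add_one_self[of "second_moment \<nu> y y / 2"] by linarith
  qed
  define c where "c = second_moment \<nu> x x + 2"
  have c: "\<bar>second_moment \<nu> x y\<bar> \<le> c" if "norm y < \<delta>" for y
  proof -
    have "0 \<le> second_moment \<nu> (x + y) (x + y)" "0 \<le> second_moment \<nu> (x - y) (x - y)"
      by (rule second_moment_nonneg)+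
    then show ?thesis
      using small[OF that] second_moment_nonneg[of x] second_moment_commute[of "x + y"] second_moment_commute[of "x - y"]
        second_moment_commute[of y x]
      by (simp add: second_moment_add second_moment_diff c_def)
  qed
  have "\<bar>second_moment \<nu> x y\<bar> \<le> (2 * c / \<delta>) * norm y" for y
  proof (cases "y = 0")
    case False
    define r where "r = \<delta> / (2 * norm y)"
    have "r > 0" using False \<open>\<delta> > 0\<close> by (simp add: r_def)
    have "norm (r *\<^sub>R y) < \<delta>" using False \<open>\<delta> > 0\<close> by (simp add: r_def)
    then have "r * \<bar>second_moment \<nu> x y\<bar> \<le> c"
      using c[of "r *\<^sub>R y"] \<open>r > 0\<close> by (simp add: second_moment_scale abs_mult)
    then show ?thesis using False \<open>\<delta> > 0\<close> by (simp add: r_def field_simps)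
  qed (simp add: second_moment_def)
  then show ?thesis by (rule that)
qed

lemma is_covariance_operator_iff:
  "is_covariance_operator \<nu> C \<longleftrightarrow> (\<forall>x y. C x \<bullet> y = second_moment \<nu> x y)"
proof -
  have "is_covariance_operator \<nu> C \<longleftrightarrow> (\<forall>x y. has_bochner_integral \<nu> (\<lambda>w. (x \<bullet> w) * (y \<bullet> w)) (C x \<bullet> y))"
  proof -
    have "is_mean \<nu> \<mu> \<longleftrightarrow> \<mu> = 0" for \<mu> using mean_zero is_mean_unique by blast
    then show ?thesis unfolding is_covariance_operator_def by simp
  qed
  then show ?thesis
    using has_bochner_second_moment has_bochner_integral_eq by metis
qed

lemma covariance_operator_exists: "\<exists>C. is_covariance_operator \<nu> C"
proof -
  have "\<exists>z. \<forall>y. z \<bullet> y = second_moment \<nu> x y" for x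
  proof -
    obtain K where K: "\<And>y. \<bar>second_moment \<nu> x y\<bar> \<le> K * norm y" 
      using second_moment_bounded[of x] by blast
    have "linear (second_moment \<nu> x)"
      by (intro linearI) (auto simp: second_moment_add second_moment_scale)
    then obtain z where "\<And>h. h \<in> UNIV \<Longrightarrow> second_moment \<nu> x h = z \<bullet> h"
      using riesz_on_closed_subspace[OF _ K, of UNIV] by auto
    then have "\<forall>y. z \<bullet> y = second_moment \<nu> x y" by simp
    then show ?thesis ..
  qed
  then show ?thesis unfolding is_covariance_operator_iff by metis
qed

lemma AE_ortho_iff: "(AE w in \<nu>. x \<bullet> w = 0) \<longleftrightarrow> second_moment \<nu> x x = 0"
  using integral_nonneg_eq_0_iff_AE[OF integrable_product[of x x]] by (simp add: second_moment_def)

section \<open>Translations along the covariance operator and full support\<close>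

text \<open>
  If the variance of \<open>(\<bullet>) x\<close> is positive, then \<open>h\<close> is the covariance operator applied to \<open>x\<close>, divided by this variance.
  Then \<open>u - (x \<bullet> u) *\<^sub>R h\<close> is uncorrelated with \<open>x \<bullet> u\<close>, and for Gaussian measures uncorrelated means
  independent: replacing the coordinate \<open>x \<bullet> u\<close> by an independent copy \<open>x \<bullet> w\<close> does not change the law.
  Comparing characteristic functionals, both sides are the exponential of the same quadratic form.
\<close>

lemma resample_direction:
  assumes h: "\<And>y. second_moment \<nu> x y = second_moment \<nu> x x * (h \<bullet> y)"
  shows "distr (\<nu> \<Otimes>\<^sub>M \<nu>) borel (\<lambda>(u, w). u + (x \<bullet> w - x \<bullet> u) *\<^sub>R h) = \<nu>" (is "distr _ _ ?T = _")
proof (rule borel_prob_eqI_char_functional)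
  interpret pair: pair_prob_space \<nu> \<nu> ..
  have [measurable]: "?T \<in> measurable (\<nu> \<Otimes>\<^sub>M \<nu>) borel" by measurable
  show "borel_prob (distr (\<nu> \<Otimes>\<^sub>M \<nu>) borel ?T)"
    by (auto simp: borel_prob_def intro!: pair.prob_space_distr)
  show "char_functional (distr (\<nu> \<Otimes>\<^sub>M \<nu>) borel ?T) = char_functional \<nu>"
  proof
    fix y
    define a where "a = y \<bullet> h"
    \<comment> \<open>\<open>a\<close> is the weight with which the resampled coordinate enters \<open>y\<close>, so that \<open>y - a *\<^sub>R x\<close> and \<open>x\<close> are uncorrelated.\<close>
    have split: "iexp (y \<bullet> ?T (u, w)) = iexp ((y - a *\<^sub>R x) \<bullet> u) * iexp ((a *\<^sub>R x) \<bullet> w)" for u w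
      by (simp add: a_def inner_add_right inner_diff_left algebra_simps flip: exp_add)
    have "char_functional (distr (\<nu> \<Otimes>\<^sub>M \<nu>) borel ?T) y = (CLINT p|\<nu> \<Otimes>\<^sub>M \<nu>. iexp (y \<bullet> ?T p))"
      unfolding char_functional_def by (subst integral_distr) auto
    also have "\<dots> = (CLINT u|\<nu>. CLINT w|\<nu>. iexp (y \<bullet> ?T (u, w)))"
      by (intro pair.integral_fst'[symmetric] pair.integrable_const_bound[of _ 1]) auto
    also have "\<dots> = char_functional \<nu> (y - a *\<^sub>R x) * char_functional \<nu> (a *\<^sub>R x)"
      unfolding split char_functional_def by simp
    also have "\<dots> = exp (- (second_moment \<nu> (y - a *\<^sub>R x) (y - a *\<^sub>R x) + second_moment \<nu> (a *\<^sub>R x) (a *\<^sub>R x)) / 2)"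
      unfolding char_functional_eq by (simp flip: of_real_mult exp_add)
    also have "second_moment \<nu> (y - a *\<^sub>R x) (y - a *\<^sub>R x) + second_moment \<nu> (a *\<^sub>R x) (a *\<^sub>R x) = second_moment \<nu> y y"
    proof -
      have "second_moment \<nu> x y = second_moment \<nu> x x * a" using h[of y] by (simp add: a_def inner_commute)
      then show ?thesis
        using second_moment_commute[of "y - a *\<^sub>R x" y] second_moment_commute[of "y - a *\<^sub>R x" x]
          second_moment_commute[of "a *\<^sub>R x" x] second_moment_commute[of y x]
        by (simp add: second_moment_diff second_moment_scale algebra_simps)
    qed
    finally show "char_functional (distr (\<nu> \<Otimes>\<^sub>M \<nu>) borel ?T) y = char_functional \<nu> y"
      by (simp add: char_functional_eq)
  qed
qed (rule borel_prob)

text \<open>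
  Resampling moves \<open>u\<close> along the line through \<open>u\<close> in direction \<open>h\<close> by a normal variable, whose density is
  positive. An open null set therefore misses almost every such line altogether, and so do its
  translates along \<open>h\<close>.
\<close>

lemma open_null_translate:
  assumes h: "\<And>y. second_moment \<nu> x y = second_moment \<nu> x x * (h \<bullet> y)" and "second_moment \<nu> x x > 0"
    and "open U" and null: "AE w in \<nu>. w \<notin> U"
  shows "AE w in \<nu>. w + t *\<^sub>R h \<notin> U"
proof -
  interpret pair: pair_prob_space \<nu> \<nu> ..
  have [measurable]: "U \<in> sets borel" using \<open>open U\<close> by simp
  have "AE w in distr (\<nu> \<Otimes>\<^sub>M \<nu>) borel (\<lambda>(u, w). u + (x \<bullet> w - x \<bullet> u) *\<^sub>R h). w \<notin> U"
    using null unfolding resample_direction[OF h] .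
  then have "AE p in \<nu> \<Otimes>\<^sub>M \<nu>. (case p of (u, w) \<Rightarrow> u + (x \<bullet> w - x \<bullet> u) *\<^sub>R h) \<notin> U"
    by (subst (asm) AE_distr_iff) auto
  from pair.AE_pair[OF this]
  have "AE u in \<nu>. AE w in \<nu>. u + (x \<bullet> w - x \<bullet> u) *\<^sub>R h \<notin> U" by simp
  then show ?thesis
  proof (rule AE_mp, intro AE_I2 impI)
    fix u assume u: "AE w in \<nu>. u + (x \<bullet> w - x \<bullet> u) *\<^sub>R h \<notin> U"
    define V where "V = {s. u + (s - x \<bullet> u) *\<^sub>R h \<in> U}"
    have "open V"
      using \<open>open U\<close> unfolding V_def vimage_def[symmetric]
      by (intro continuous_open_vimage continuous_intros)
    then have [measurable]: "V \<in> sets borel" by simp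
    have "AE s in distr \<nu> borel (\<lambda>w. x \<bullet> w). s \<notin> V"
      using u by (subst AE_distr_iff) (auto simp: V_def)
    then have "V = {}"
      unfolding marginal_eq using assms(2)
      by (intro open_null_normal_distribution[OF _ \<open>open V\<close>, of "sqrt (second_moment \<nu> x x)" 0]) simp_all
    then have "t + x \<bullet> u \<notin> V" by simp
    then show "u + t *\<^sub>R h \<notin> U" by (simp add: V_def)
  qed
qed

text \<open>
  By the preceding lemma the largest open null set is invariant under translation by the range of the covariance
  operator \<open>C\<close>. It misses some point \<open>a\<close>, hence \<open>a + range C\<close>, which is dense because a vector orthogonal to
  the range of \<open>C\<close> satisfies \<open>C y \<bullet> y = 0\<close>. An open set that misses a dense set is empty.
\<close>

theorem nondegenerate_full_support:
  assumes "nondegenerate \<nu>" "open U" "AE w in \<nu>. w \<notin> U"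
  shows "U = {}"
proof -
  obtain C where "is_covariance_operator \<nu> C" and pos: "\<And>x. x \<noteq> 0 \<Longrightarrow> C x \<bullet> x > 0"
    using assms(1) unfolding nondegenerate_def by blast
  then have C: "C x \<bullet> y = second_moment \<nu> x y" for x y
    by (simp add: is_covariance_operator_iff)
  define N where "N = {U. open U \<and> (AE w in \<nu>. w \<notin> U)}"
  have "open (\<Union>N)" by (auto simp: N_def)
  \<comment> \<open>Lindelof makes the union of all open null sets a countable one, hence itself null.\<close>
  obtain N' where "N' \<subseteq> N" "countable N'" "\<Union>N' = \<Union>N"
    using Lindelof[of N] by (auto simp: N_def)
  have "AE w in \<nu>. \<forall>U\<in>N'. w \<notin> U"
    using \<open>countable N'\<close> \<open>N' \<subseteq> N\<close> by (subst AE_ball_countable) (auto simp: N_def)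
  then have null: "AE w in \<nu>. w \<notin> \<Union>N" unfolding \<open>\<Union>N' = \<Union>N\<close>[symmetric] by simp
  have "\<not> (AE w in \<nu>. False)" by simp
  then obtain a where "a \<notin> \<Union>N" using null eventually_mono[OF null, of "\<lambda>_. False"] by blast
  have shift: "a + C x \<notin> \<Union>N" for x
  proof (cases "x = 0")
    case True
    have "C 0 \<bullet> C 0 = 0" unfolding C by (simp add: second_moment_def)
    then show ?thesis using True \<open>a \<notin> \<Union>N\<close> by simp
  next
    case False
    define s where "s = second_moment \<nu> x x"
    have "s > 0" using pos[OF False] by (simp add: C s_def)
    have "second_moment \<nu> x y = second_moment \<nu> x x * ((C x /\<^sub>R s) \<bullet> y)" for y
      using \<open>s > 0\<close> by (simp add: C s_def)
    from open_null_translate[OF this _ \<open>open (\<Union>N)\<close> null, of s] \<open>s > 0\<close>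
    have "AE w in \<nu>. w + C x \<notin> \<Union>N" by (simp add: s_def)
    then have "AE w in \<nu>. w \<notin> {w. w + C x \<in> \<Union>N}" by simp
    moreover have "open {w. w + C x \<in> \<Union>N}"
      using \<open>open (\<Union>N)\<close> unfolding vimage_def[symmetric]
      by (intro continuous_open_vimage continuous_intros)
    ultimately have "{w. w + C x \<in> \<Union>N} \<in> N" by (simp add: N_def)
    then show ?thesis using \<open>a \<notin> \<Union>N\<close> by blast
  qed
  have "linear C"
  proof (rule linearI)
    show "C (x + y) = C x + C y" for x y
      by (rule vector_eq_rdot[THEN iffD1]) (metis C inner_add_left second_moment_add second_moment_commute)
    show "C (c *\<^sub>R x) = c *\<^sub>R C x" for c x
      by (rule vector_eq_rdot[THEN iffD1]) (metis C inner_scaleR_left second_moment_scale second_moment_commute)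
  qed
  then have "subspace (range C)" by (rule linear_subspace_image) simp
  then have "closure (range C) = UNIV"
  proof (rule dense_subspaceI)
    fix y assume "\<And>h. h \<in> range C \<Longrightarrow> y \<bullet> h = 0"
    then have "C y \<bullet> y = 0" by (metis inner_commute rangeI)
    then show "y = 0" using pos[of y] by fastforce
  qed
  have "\<Union>N = {}"
  proof (rule ccontr)
    assume "\<Union>N \<noteq> {}"
    then obtain p where "p \<in> \<Union>N" by blast
    have "open {v. a + v \<in> \<Union>N}"
      using \<open>open (\<Union>N)\<close> unfolding vimage_def[symmetric]
      by (intro continuous_open_vimage continuous_intros)
    moreover have "p - a \<in> {v. a + v \<in> \<Union>N}" using \<open>p \<in> \<Union>N\<close> by simp
    ultimately have "{v. a + v \<in> \<Union>N} \<inter> range C \<noteq> {}"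
      using \<open>closure (range C) = UNIV\<close> open_Int_closure_eq_empty by blast
    then show False using shift by blast
  qed
  then show ?thesis using assms(2,3) by (auto simp: N_def)
qed

end

section \<open>Characteristic Gaussian measures\<close>

lemma Ed_sq_eq_0_iff:
  assumes "borel_prob \<nu>" "borel_prob P" "borel_prob Q"
  shows "Ed_sq \<nu> P Q = 0 \<longleftrightarrow> (AE w in \<nu>. char_functional P w = char_functional Q w)"
proof -
  interpret \<nu>: prob_space \<nu> using assms by (simp add: borel_prob_def)
  have [measurable_cong]: "sets \<nu> = sets borel" using assms by (simp add: borel_prob_def)
  have [measurable]: "char_functional P \<in> borel_measurable borel" "char_functional Q \<in> borel_measurable borel"
    using assms continuous_char_functional by (auto intro: borel_measurable_continuous_onI)
  have le1: "cmod (char_functional M w) \<le> 1" if "borel_prob M" for M w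
  proof -
    interpret M: prob_space M using that by (simp add: borel_prob_def)
    have "cmod (char_functional M w) \<le> (LINT z|M. 1)"
      unfolding char_functional_def by (rule order_trans[OF integral_norm_bound]) simp
    then show ?thesis by (simp add: M.prob_space)
  qed
  have "cmod (char_functional P w - char_functional Q w) \<le> 2" for w
    using norm_triangle_ineq4[of "char_functional P w" "char_functional Q w"] le1[OF assms(2), of w] le1[OF assms(3), of w] by simp
  then have "integrable \<nu> (\<lambda>w. (cmod (char_functional P w - char_functional Q w))\<^sup>2)"
    using power_mono[of _ 2 2] by (intro \<nu>.integrable_const_bound[of _ 4]) (fastforce simp: abs_of_nonneg)+
  then show ?thesis
    unfolding Ed_sq_def by (subst integral_nonneg_eq_0_iff_AE) auto
qed

theorem corollary2p6:
  fixes \<nu> :: "'a::{real_inner, polish_space} measure"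
  assumes "infinite_dimensional TYPE('a)"
    and "gaussian \<nu>"
    and "is_mean \<nu> 0"
  shows "characteristic \<nu> \<longleftrightarrow> nondegenerate \<nu>"
proof -
  interpret centered_gaussian \<nu> using assms by unfold_locales
  show ?thesis
  proof
    assume char: "characteristic \<nu>"
    obtain C where C: "is_covariance_operator \<nu> C" using covariance_operator_exists by blast
    have "C x \<bullet> x > 0" if "x \<noteq> 0" for x
    proof (rule ccontr)
      assume "\<not> C x \<bullet> x > 0"
      then have "second_moment \<nu> x x = 0"
        using C second_moment_nonneg[of x] by (simp add: is_covariance_operator_iff)
      then have ortho: "AE w in \<nu>. x \<bullet> w = 0" by (simp add: AE_ortho_iff)
      \<comment> \<open>The point masses at \<open>x\<close> and \<open>0\<close> cannot be distinguished by functionals orthogonal to \<open>x\<close>, and almost every \<open>w\<close> is one.\<close>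
      have dirac: "borel_prob (return borel z)" "char_functional (return borel z) w = iexp (w \<bullet> z)" for z w :: 'a
        by (simp_all add: borel_prob_def prob_space_return char_functional_def integral_return)
      have "Ed_sq \<nu> (return borel x) (return borel 0) = 0"
        unfolding Ed_sq_eq_0_iff[OF borel_prob dirac(1) dirac(1)] dirac(2)
        using ortho by eventually_elim (simp add: inner_commute)
      then have "return borel x = return borel 0"
        using char dirac(1) by (auto simp: characteristic_def)
      then have "emeasure (return borel x) {x} = emeasure (return borel 0) {x}" by simp
      then show False using \<open>x \<noteq> 0\<close> by simp
    qed
    then show "nondegenerate \<nu>" using C by (auto simp: nondegenerate_def)
  next
    assume nd: "nondegenerate \<nu>"
    show "characteristic \<nu>"
      unfolding characteristic_def
    proof (intro conjI allI impI borel_prob iffI)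
      fix P Q :: "'a measure" assume P: "borel_prob P" and Q: "borel_prob Q"
      assume "Ed_sq \<nu> P Q = 0"
      then have "AE w in \<nu>. w \<notin> {w. char_functional P w \<noteq> char_functional Q w}"
        by (simp add: Ed_sq_eq_0_iff[OF borel_prob P Q])
      \<comment> \<open>Continuity turns almost sure equality into equality on the support of \<open>\<nu>\<close>, which is everything.\<close>
      moreover have "open {w. char_functional P w \<noteq> char_functional Q w}"
        by (intro open_Collect_neq continuous_char_functional P Q)
      ultimately have "{w. char_functional P w \<noteq> char_functional Q w} = {}"
        using nondegenerate_full_support[OF nd] by blast
      then show "P = Q" by (intro borel_prob_eqI_char_functional P Q) auto
    qed (simp add: Ed_sq_def)
  qed
qed

end
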